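(* For every Dyck path $\lambda$ and every $\sigma\in\mathscr{L}(P_\lambda)$, $\operatorname{art}(\operatorname{DTS}(\lambda,\sigma))=\operatorname{inv}(\sigma)$, where $\operatorname{inv}(\sigma)=\#\{(i,j):i<j,\ \sigma(i)>\sigma(j)\}$.
   Context: Dyck paths. A Dyck path of order $n$ is a lattice path from $(-n,0)$ to $(n,0)$ with steps $(+1,+1)$ (up step, U) and $(+1,-1)$ (down step, D) that never goes below the $x$-axis; we write $\rho(x)$ for its height at the integer $x$, and number its steps $1,\dots,2n$ from left to right. Column $s$ means the vertical line $x=s$. Skew shapes and Dyck tilings. A box is a square with vertices $(x,y),(x+1,y+1),(x,y+2),(x-1,y+1)$; $(x,y)$ is its lower corner and it lies in column $x$. For Dyck paths $\lambda,\mu$ of order $n$ with $\mu(x)\ge\lambda(x)$ for all $x$, the skew shape $\lambda/\mu$ is the set of boxes lying between $\lambda$ and $\mu$. A Dyck tile is a nonempty set of boxes, one in each of a set of consecutive columns, whose lower corners, read left to right, form a lattice path with steps $(+1,\pm1)$ whose first and last points have the same height and no point is lower than them. A Dyck tiling of $\lambda/\mu$ is a partition of its boxes into Dyck tiles (lower path $\lambda$, upper path $\mu$, order $n$). Tile $A$ covers tile $B$ if some box of $A$ lies directly above some box of $B$; the tiling is cover-inclusive if whenever $A$ covers $B$, the set of columns of $A$ is contained in that of $B$. For a tiling $T$: $\operatorname{area}(T)$ = number of boxes, $\operatorname{tiles}(T)$ = number of tiles, $\operatorname{art}(T)=(\operatorname{area}(T)+\operatorname{tiles}(T))/2$. Chords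 and linear extensions. Each up step is matched with a down step as in balanced parentheses; such a pair is a chord. The chord poset $P_\lambda$: $c<c'$ iff both steps of $c'$ lie strictly between those of $c$. A natural labeling is a bijection $L:P_\lambda\to[n]$ with $L(c)<L(c')$ whenever $c<c'$; $L_0$ numbers chords by the left-to-right order of their up steps; $\mathscr{L}(P_\lambda)=\{L_0\circ L^{-1}:L\text{ natural}\}\subseteq S_n$. Growth sequences. A growth sequence of length $n$ is $(p_1,\dots,p_n)$ with $0\le p_i\le 2(i-1)$. From it build $(\lambda,L)$: start with the empty word and for $i=1,\dots,n$ insert UD immediately after the first $p_i$ letters of the current word, labeling the new chord $i$. This is a bijection onto pairs (Dyck path $\lambda$ of order $n$, natural labeling of $P_\lambda$); let $p(\lambda,\sigma)$ be the growth sequence giving $(\lambda,L)$ with $L_0\circ L^{-1}=\sigma$. Spread. The spread at column $s$ of a path $\rho$ (a set of lattice points) is $\{(x-1,y):(x,y)\in\rho,x\le s\}\cup\{(x,y+1):(x,y)\in\rho,x=s\}\cup\{(x+1,y):(x,y)\in\rho,x\ge s\}$; the spread of a tile spreads its lower-corner path; the spread of a tiling spreads its lower path, upper path and all tiles. Strip-grow and DTS. For a Dyck tiling $T$ of order $n$ and $-n\le s\le n$, let $T''$ be the spread of $T$ at $s$ with upper path $\mu''$; $\mathrm{sgrow}(T,s)$ is obtained from $T''$ by adding, for every up step of $\mu''$ from $(a,h)$ to $(a+1,h+1)$ with $a\ge s$, the one-box tile with lower corner $(a,h)$. $\operatorname{DTS}()$ is the empty tiling of order 0 and $\operatorname{DTS}(p_1,\dots,p_n)=\mathrm{sgrow}(\operatorname{DTS}(p_1,\dots,p_{n-1}),p_n-(n-1))$;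 $\operatorname{DTS}(\lambda,\sigma)=\operatorname{DTS}(p(\lambda,\sigma))$. *)

theory Defs
  imports Complex_Main "HOL-Library.Disjoint_Sets"
begin

section \<open>Dyck paths and lattice paths\<close>

datatype step = U | D

definition height :: "step list \<Rightarrow> int" where
  "height w = (\<Sum>s\<leftarrow>w. case s of U \<Rightarrow> 1 | D \<Rightarrow> - 1)"

definition dyck_path :: "nat \<Rightarrow> step list \<Rightarrow> bool" where
  "dyck_path n w \<longleftrightarrow> length w = 2 * n \<and> height w = 0 \<and> (\<forall>k\<le>length w. 0 \<le> height (take k w))"

text \<open>The lattice points visited when walking along \<open>w\<close> from a given starting point.
  A Dyck path of order \<open>n\<close> is drawn from \<open>(-n, 0)\<close>.\<close>

fun trace :: "int \<times> int \<Rightarrow> step list \<Rightarrow> (int \<times> int) set" where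
  "trace (a, h) w = {(a + int k, h + height (take k w)) | k. k \<le> length w}"

section \<open>Skew shapes and Dyck tilings\<close>

text \<open>A box is identified with its lower corner \<open>(x, y)\<close>; its upper corner is \<open>(x, y + 2)\<close>.  Since
  the paths move by \<open>\<plusminus>1\<close> in each column, a box lies between them iff its lower corner is weakly
  above the lower path and its upper corner is weakly below the upper path.  The parity condition
  selects the boxes whose vertices are on the sublattice containing the two paths.\<close>

definition skew_shape :: "(int \<times> int) set \<Rightarrow> (int \<times> int) set \<Rightarrow> (int \<times> int) set" where
  "skew_shape lo up =
     {(x, y). \<exists>l u. (x, l) \<in> lo \<and> (x, u) \<in> up \<and> l \<le> y \<and> y + 2 \<le> u \<and> even (y - l)}"

text \<open>The lower corners of a tile form a translate of a Dyck path; a single box corresponds to the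
  path of order \<open>0\<close>.\<close>

definition dyck_tile :: "(int \<times> int) set \<Rightarrow> bool" where
  "dyck_tile B \<longleftrightarrow> (\<exists>a h m v. dyck_path m v \<and> B = trace (a, h) v)"

record tiling =
  lower :: "(int \<times> int) set"
  upper :: "(int \<times> int) set"
  tiles :: "(int \<times> int) set set"

definition dyck_tiling :: "nat \<Rightarrow> tiling \<Rightarrow> bool" where
  "dyck_tiling n T \<longleftrightarrow>
     (\<exists>l m. dyck_path n l \<and> dyck_path n m \<and>
        (\<forall>k\<le>2 * n. height (take k l) \<le> height (take k m)) \<and>
        lower T = trace (- int n, 0) l \<and> upper T = trace (- int n, 0) m) \<and>
     partition_on (skew_shape (lower T) (upper T)) (tiles T) \<and>
     (\<forall>B\<in>tiles T. dyck_tile B)"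

definition area :: "tiling \<Rightarrow> nat" where
  "area T = card (\<Union>(tiles T))"

definition art :: "tiling \<Rightarrow> real" where
  "art T = (real (area T) + real (card (tiles T))) / 2"

section \<open>Chords and linear extensions\<close>

text \<open>A chord is given by the (0-based) positions of its up step and of its matching down step.\<close>

definition chords :: "step list \<Rightarrow> (nat \<times> nat) set" where
  "chords w = {(i, j). i < j \<and> j < length w \<and> w ! i = U \<and> w ! j = D \<and>
     (\<exists>m. dyck_path m (take (j - Suc i) (drop (Suc i) w)))}"

definition chord_less :: "nat \<times> nat \<Rightarrow> nat \<times> nat \<Rightarrow> bool" where
  "chord_less c c' \<longleftrightarrow> fst c < fst c' \<and> snd c' < snd c"

definition natural_labeling :: "nat \<Rightarrow> step list \<Rightarrow> (nat \<times> nat \<Rightarrow> nat) \<Rightarrow> bool" where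
  "natural_labeling n w L \<longleftrightarrow>
     bij_betw L (chords w) {1..n} \<and>
     (\<forall>c\<in>chords w. \<forall>c'\<in>chords w. chord_less c c' \<longrightarrow> L c < L c')"

definition L0 :: "step list \<Rightarrow> nat \<times> nat \<Rightarrow> nat" where
  "L0 w c = card {c' \<in> chords w. fst c' \<le> fst c}"

text \<open>The permutation \<open>L\<^sub>0 \<circ> L\<^sup>-\<^sup>1\<close> of \<open>{1..n}\<close>, extended by the identity to all of \<open>nat\<close>.\<close>

definition perm_of :: "nat \<Rightarrow> step list \<Rightarrow> (nat \<times> nat \<Rightarrow> nat) \<Rightarrow> nat \<Rightarrow> nat" where
  "perm_of n w L i = (if i \<in> {1..n} then L0 w (inv_into (chords w) L i) else i)"

definition linear_extensions :: "nat \<Rightarrow> step list \<Rightarrow> (nat \<Rightarrow> nat) set" where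
  "linear_extensions n w = {perm_of n w L | L. natural_labeling n w L}"

definition inversions :: "nat \<Rightarrow> (nat \<Rightarrow> nat) \<Rightarrow> nat" where
  "inversions n \<sigma> = card {(i, j). i \<in> {1..n} \<and> j \<in> {1..n} \<and> i < j \<and> \<sigma> i > \<sigma> j}"

section \<open>Growth sequences\<close>

text \<open>Lists are indexed from \<open>0\<close>, so that \<open>p ! i\<close> is the entry \<open>p\<^sub>i\<^sub>+\<^sub>1\<close>.\<close>

definition growth_sequence :: "nat \<Rightarrow> nat list \<Rightarrow> bool" where
  "growth_sequence n p \<longleftrightarrow> length p = n \<and> (\<forall>i<n. p ! i \<le> 2 * i)"

text \<open>Both letters of an inserted chord carry its label.\<close>

definition grow :: "nat list \<Rightarrow> (step \<times> nat) list" where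
  "grow p = fold (\<lambda>i v. take (p ! i) v @ [(U, Suc i), (D, Suc i)] @ drop (p ! i) v)
     [0..<length p] []"

definition grown_path :: "nat list \<Rightarrow> step list" where
  "grown_path p = map fst (grow p)"

definition grown_labeling :: "nat list \<Rightarrow> nat \<times> nat \<Rightarrow> nat" where
  "grown_labeling p c = snd (grow p ! fst c)"

definition growth_of :: "nat \<Rightarrow> step list \<Rightarrow> (nat \<Rightarrow> nat) \<Rightarrow> nat list" where
  "growth_of n w \<sigma> =
     (THE p. growth_sequence n p \<and> grown_path p = w \<and> perm_of n w (grown_labeling p) = \<sigma>)"

section \<open>Spread, strip-grow and DTS\<close>

definition spread :: "int \<Rightarrow> (int \<times> int) set \<Rightarrow> (int \<times> int) set" where
  "spread s P = {(x - 1, y) | x y. (x, y) \<in> P \<and> x \<le> s}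
     \<union> {(x, y + 1) | x y. (x, y) \<in> P \<and> x = s}
     \<union> {(x + 1, y) | x y. (x, y) \<in> P \<and> s \<le> x}"

definition spread_tiling :: "int \<Rightarrow> tiling \<Rightarrow> tiling" where
  "spread_tiling s T =
     \<lparr>lower = spread s (lower T), upper = spread s (upper T), tiles = spread s ` tiles T\<rparr>"

text \<open>Starting points of the up steps of a path at or to the right of column \<open>s\<close>.\<close>

definition up_starts :: "int \<Rightarrow> (int \<times> int) set \<Rightarrow> (int \<times> int) set" where
  "up_starts s P = {(a, h). (a, h) \<in> P \<and> (a + 1, h + 1) \<in> P \<and> s \<le> a}"

text \<open>The new upper path is the upper boundary of the enlarged shape: adding a box with lower corner
  \<open>(a, h)\<close> on top of the path replaces the point \<open>(a, h)\<close> of the path by \<open>(a, h + 2)\<close>.\<close>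

definition sgrow :: "tiling \<Rightarrow> int \<Rightarrow> tiling" where
  "sgrow T s =
     (let T'' = spread_tiling s T; A = up_starts s (upper T'') in
      \<lparr>lower = lower T'',
       upper = (upper T'' - A) \<union> {(a, h + 2) | a h. (a, h) \<in> A},
       tiles = tiles T'' \<union> {{c} | c. c \<in> A}\<rparr>)"

definition empty_tiling :: tiling where
  "empty_tiling = \<lparr>lower = {(0, 0)}, upper = {(0, 0)}, tiles = {}\<rparr>"

definition DTS :: "nat list \<Rightarrow> tiling" where
  "DTS p = fold (\<lambda>i T. sgrow T (int (p ! i) - int i)) [0..<length p] empty_tiling"

definition DTS_of :: "nat \<Rightarrow> step list \<Rightarrow> (nat \<Rightarrow> nat) \<Rightarrow> tiling" where
  "DTS_of n w \<sigma> = DTS (growth_of n w \<sigma>)"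

section \<open>DTS produces Dyck tilings\<close>

lemma height_simps [simp]:
  "height [] = 0" "height (U # w) = 1 + height w" "height (D # w) = height w - 1"
  "height (v @ w) = height v + height w"
  by (simp_all add: height_def)

lemma mem_spread:
  "(x, y) \<in> spread s P \<longleftrightarrow>
     x < s \<and> (x + 1, y) \<in> P \<or> x = s \<and> (s, y - 1) \<in> P \<or> s < x \<and> (x - 1, y) \<in> P"
proof -
  have "(\<exists>x' y'. (x, y) = (x' - 1, y') \<and> (x', y') \<in> P \<and> x' \<le> s) \<longleftrightarrow> (x + 1, y) \<in> P \<and> x < s"
    by (auto intro!: exI[of _ "x + 1"])
  moreover have "(\<exists>x' y'. (x, y) = (x', y' + 1) \<and> (x', y') \<in> P \<and> x' = s) \<longleftrightarrow> x = s \<and> (s, y - 1) \<in> P"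
    by (auto intro!: exI[of _ "y - 1"])
  moreover have "(\<exists>x' y'. (x, y) = (x' + 1, y') \<and> (x', y') \<in> P \<and> s \<le> x') \<longleftrightarrow> (x - 1, y) \<in> P \<and> s < x"
    by (auto intro!: exI[of _ "x - 1"])
  ultimately show ?thesis unfolding spread_def Un_iff mem_Collect_eq by blast
qed

lemma mem_trace:
  "(x, y) \<in> trace (a, h) w \<longleftrightarrow>
     a \<le> x \<and> x \<le> a + int (length w) \<and> y = h + height (take (nat (x - a)) w)"
  (is "?l \<longleftrightarrow> ?r")
proof
  assume ?r
  then show ?l by (auto intro!: exI[of _ "nat (x - a)"])
qed auto

lemma height_take_insert:
  assumes "k \<le> length w"
  shows "height (take j (take k w @ [U, D] @ drop k w)) =
    (if j \<le> k then height (take j w) else if j = Suc k then height (take k w) + 1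
     else height (take (j - 2) w))"
proof -
  consider "j \<le> k" | "j = Suc k" | "Suc k < j" by linarith
  then show ?thesis
  proof cases
    case 1
    then show ?thesis using assms by (simp add: min_def)
  next
    case 2
    then show ?thesis using assms by (simp add: min_def)
  next
    case 3
    define i where "i = j - k - 2"
    have i: "j = k + 2 + i" using 3 by (simp add: i_def)
    have "take (k + i) w = take k w @ take i (drop k w)" by (rule take_add)
    then show ?thesis using assms by (simp add: i min_def)
  qed
qed

lemma height_take_strip:
  assumes "k \<le> length w"
  shows "height (take j (take k w @ U # drop k w @ [D])) =
    (if j \<le> k then height (take j w) else if j \<le> Suc (length w) then height (take (j - 1) w) + 1
     else height w)"
proof -
  consider "j \<le> k" | "k < j" "j \<le> Suc (length w)" | "k < j" "Suc (length w) < j" by linarith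
  then show ?thesis
  proof cases
    case 1
    then show ?thesis using assms by (simp add: min_def)
  next
    case 2
    define i where "i = j - k - 1"
    have i: "j = k + 1 + i" using 2 by (simp add: i_def)
    have "take (k + i) w = take k w @ take i (drop k w)" by (rule take_add)
    then show ?thesis using assms 2 by (cases "k = length w") (auto simp: i min_def)
  next
    case 3
    have "height w = height (take k w) + height (drop k w)"
      by (metis append_take_drop_id height_simps(4))
    with 3 show ?thesis using assms by (simp add: min_def)
  qed
qed

lemma spread_trace:
  assumes "k \<le> length w"
  shows "spread (a + int k) (trace (a, h) w) = trace (a - 1, h) (take k w @ [U, D] @ drop k w)"
proof -
  have "(x, y) \<in> spread (a + int k) (trace (a, h) w) \<longleftrightarrow>
      (x, y) \<in> trace (a - 1, h) (take k w @ [U, D] @ drop k w)" for x y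
  proof -
    consider "x < a - 1" | "a - 1 \<le> x" "x < a + int k" | "x = a + int k" | "a + int k < x" by linarith
    then show ?thesis
    proof cases
      case 1
      then show ?thesis using assms by (auto simp: mem_spread mem_trace)
    next
      case 2
      then have "nat (x - (a - 1)) \<le> k" "nat (x + 1 - a) = nat (x - (a - 1))" by auto
      then show ?thesis using assms 2
        unfolding mem_spread mem_trace height_take_insert[OF assms] by auto
    next
      case 3
      then have "nat (x - (a - 1)) = Suc k" by auto
      then show ?thesis using assms 3
        unfolding mem_spread mem_trace height_take_insert[OF assms] by auto
    next
      case 4
      then have "nat (x - (a - 1)) > Suc k" "nat (x - 1 - a) = nat (x - (a - 1)) - 2" by auto
      then show ?thesis using assms 4
        unfolding mem_spread mem_trace height_take_insert[OF assms] by auto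
    qed
  qed
  then show ?thesis by auto
qed

lemma dyck_path_insert:
  assumes "dyck_path n w" "k \<le> length w"
  shows "dyck_path (Suc n) (take k w @ [U, D] @ drop k w)"
proof -
  have "height w = height (take k w) + height (drop k w)"
    by (metis append_take_drop_id height_simps(4))
  moreover have "0 \<le> height (take j w)" for j
    using assms(1) by (cases "j \<le> length w") (auto simp: dyck_path_def)
  then have "0 \<le> height (take j (take k w @ [U, D] @ drop k w))" for j
    unfolding height_take_insert[OF assms(2)] by (auto intro: add_nonneg_nonneg)
  ultimately show ?thesis using assms by (simp add: dyck_path_def)
qed

lemma dyck_path_strip:
  assumes "dyck_path n w" "k \<le> length w"
  shows "dyck_path (Suc n) (take k w @ U # drop k w @ [D])"
proof -
  have "height w = height (take k w) + height (drop k w)"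
    by (metis append_take_drop_id height_simps(4))
  moreover have "0 \<le> height (take j (take k w @ U # drop k w @ [D]))" for j
    unfolding height_take_strip[OF assms(2)]
    using assms(1,2) by (auto simp: dyck_path_def intro: add_nonneg_nonneg)
  ultimately show ?thesis using assms by (simp add: dyck_path_def)
qed

lemma dyck_tile_spread:
  assumes "dyck_tile B"
  shows "dyck_tile (spread s B)"
proof -
  obtain a h m v where v: "dyck_path m v" "B = trace (a, h) v"
    using assms unfolding dyck_tile_def by blast
  consider "s < a" | "a \<le> s" "s \<le> a + int (length v)" | "a + int (length v) < s" by linarith
  then show ?thesis
  proof cases
    case 1
    have "spread s B = trace (a + 1, h) v"
      using 1 by (auto simp: v(2) mem_spread mem_trace simp del: trace.simps) (auto simp: algebra_simps)
    then show ?thesis using v(1) unfolding dyck_tile_def by blast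
  next
    case 2
    define k where "k = nat (s - a)"
    have "k \<le> length v" "s = a + int k" using 2 by (auto simp: k_def)
    then show ?thesis
      using spread_trace dyck_path_insert[OF v(1)] unfolding dyck_tile_def v(2) by metis
  next
    case 3
    have "spread s B = trace (a - 1, h) v"
      using 3 by (auto simp: v(2) mem_spread mem_trace simp del: trace.simps) (auto simp: algebra_simps)
    then show ?thesis using v(1) unfolding dyck_tile_def by blast
  qed
qed

lemma skew_shape_spread: "skew_shape (spread s P) (spread s Q) = spread s (skew_shape P Q)"
proof -
  have "(x, y) \<in> skew_shape (spread s P) (spread s Q) \<longleftrightarrow> (x, y) \<in> spread s (skew_shape P Q)" for x y
  proof (cases "x = s")
    case True
    show ?thesis
    proof
      assume "(x, y) \<in> skew_shape (spread s P) (spread s Q)"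
      then obtain l u where "(s, l - 1) \<in> P" "(s, u - 1) \<in> Q" "l \<le> y" "y + 2 \<le> u" "even (y - l)"
        using True by (auto simp: skew_shape_def mem_spread)
      then have "(s, l - 1) \<in> P \<and> (s, u - 1) \<in> Q \<and> l - 1 \<le> y - 1 \<and> y - 1 + 2 \<le> u - 1 \<and>
          even (y - 1 - (l - 1))" by simp
      then have "(s, y - 1) \<in> skew_shape P Q" unfolding skew_shape_def by blast
      then show "(x, y) \<in> spread s (skew_shape P Q)" using True by (simp add: mem_spread)
    next
      assume "(x, y) \<in> spread s (skew_shape P Q)"
      then have "(s, y - 1) \<in> skew_shape P Q" using True by (simp add: mem_spread)
      then obtain l u where "(s, l) \<in> P" "(s, u) \<in> Q" "l \<le> y - 1" "y - 1 + 2 \<le> u" "even (y - 1 - l)"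
        unfolding skew_shape_def by blast
      then have "(x, l + 1) \<in> spread s P \<and> (x, u + 1) \<in> spread s Q \<and> l + 1 \<le> y \<and> y + 2 \<le> u + 1 \<and>
          even (y - (l + 1))" using True by (simp add: mem_spread algebra_simps)
      then show "(x, y) \<in> skew_shape (spread s P) (spread s Q)" unfolding skew_shape_def by blast
    qed
  next
    case False
    then show ?thesis by (cases "x < s") (auto simp: skew_shape_def mem_spread)
  qed
  then show ?thesis by auto
qed

lemma spread_disjoint: "P \<inter> Q = {} \<Longrightarrow> spread s P \<inter> spread s Q = {}"
  by (auto simp: mem_spread)

lemma spread_nonempty: "P \<noteq> {} \<Longrightarrow> spread s P \<noteq> {}"
proof -
  assume "P \<noteq> {}"
  then obtain x y where "(x, y) \<in> P" by auto
  then have "(x - 1, y) \<in> spread s P \<or> (x + 1, y) \<in> spread s P"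
    by (auto simp: mem_spread)
  then show ?thesis by blast
qed

lemma spread_Union: "\<Union>(spread s ` S) = spread s (\<Union>S)"
  by (auto simp: mem_spread)

lemma partition_on_spread:
  assumes "partition_on A S"
  shows "partition_on (spread s A) (spread s ` S)"
proof (rule partition_onI)
  show "\<Union>(spread s ` S) = spread s A"
    using assms by (simp add: spread_Union partition_on_def)
  show "disjnt p q" if pq: "p \<in> spread s ` S" "q \<in> spread s ` S" "p \<noteq> q" for p q
  proof -
    obtain p' q' where "p' \<in> S" "q' \<in> S" "p = spread s p'" "q = spread s q'"
      using pq by blast
    then show ?thesis
      using pq(3) partition_onD2[OF assms] spread_disjoint[of p' q']
      by (auto simp: disjnt_def dest: disjointD)
  qed
  show "{} \<notin> spread s ` S"
    using partition_onD3[OF assms] spread_nonempty by (metis imageE)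
qed

lemma dyck_tiling_sgrow:
  assumes T: "dyck_tiling n T" and s: "- int n \<le> s" "s \<le> int n"
  shows "dyck_tiling (Suc n) (sgrow T s)"
proof -
  obtain l m where lm: "dyck_path n l" "dyck_path n m"
      "\<And>j. j \<le> 2 * n \<Longrightarrow> height (take j l) \<le> height (take j m)"
      "lower T = trace (- int n, 0) l" "upper T = trace (- int n, 0) m"
    and part: "partition_on (skew_shape (lower T) (upper T)) (tiles T)"
    and tile: "\<And>B. B \<in> tiles T \<Longrightarrow> dyck_tile B"
    using T unfolding dyck_tiling_def by blast
  define k where "k = nat (s + int n)"
  have sk: "s = - int n + int k" using s by (simp add: k_def)
  have len: "length l = 2 * n" "length m = 2 * n" using lm by (auto simp: dyck_path_def)
  have k: "k \<le> length l" "k \<le> length m" using s len by (auto simp: k_def)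
  define l' m' u' where "l' = take k l @ [U, D] @ drop k l"
    and "m' = take k m @ [U, D] @ drop k m" and "u' = take k m @ U # drop k m @ [D]"
  define A where "A = up_starts s (spread s (upper T))"
  have len': "length l' = 2 * Suc n" "length m' = 2 * Suc n" "length u' = 2 * Suc n"
    using len k by (auto simp: l'_def m'_def u'_def)
  have neg: "- int (Suc n) = - int n - 1" by simp
  have lo: "spread s (lower T) = trace (- int (Suc n), 0) l'"
    using spread_trace[OF k(1), of "- int n" 0]
    unfolding lm(4) sk l'_def neg .
  have up: "spread s (upper T) = trace (- int (Suc n), 0) m'"
    using spread_trace[OF k(2), of "- int n" 0]
    unfolding lm(5) sk m'_def neg .
  have step: "height (take (Suc j) w) = height (take j w) + 1 \<or>
      height (take (Suc j) w) = height (take j w) - 1" if "j < length w" for j and w :: "step list"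
    using that by (cases "w ! j") (auto simp: take_Suc_conv_app_nth)
  have hu: "height (take j u') = (if k < j \<and> j < 2 * Suc n \<and>
        height (take (Suc j) m') = height (take j m') + 1
      then height (take j m') + 2 else height (take j m'))" if j: "j \<le> 2 * Suc n" for j
  proof -
    have "j \<le> k \<or> j = Suc k \<or> Suc k < j \<and> j \<le> Suc (2 * n) \<or> j = Suc (Suc (2 * n))"
      using j by arith
    then consider "j \<le> k" | "j = Suc k" | "Suc k < j" "j \<le> Suc (2 * n)" | "j = Suc (Suc (2 * n))"
      by blast
    then show ?thesis
    proof cases
      case 3
      define i where "i = j - 2"
      have i: "j = Suc (Suc i)" "k \<le> i" "i < length m" using 3 len by (auto simp: i_def)
      show ?thesis using step[OF i(3)] 3 i len k
        unfolding u'_def m'_def height_take_strip[OF k(2)] height_take_insert[OF k(2)] by auto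
    next
      case 4
      then show ?thesis using k len lm(2)
        unfolding u'_def m'_def height_take_strip[OF k(2)] height_take_insert[OF k(2)]
        by (auto simp: dyck_path_def)
    qed (use k len in \<open>auto simp: u'_def m'_def height_take_strip[OF k(2)] height_take_insert[OF k(2)]\<close>)
  qed
  have tr: "(x, y) \<in> trace (- int (Suc n), 0) w \<longleftrightarrow>
      (\<exists>j. j \<le> 2 * Suc n \<and> x = int j - int (Suc n) \<and> y = height (take j w))"
    if "length w = 2 * Suc n" for x y and w :: "step list"
    using that by (auto simp: algebra_simps)
  have A: "(x, y) \<in> A \<longleftrightarrow> (\<exists>j. x = int j - int (Suc n) \<and> k < j \<and> j < 2 * Suc n \<and>
      y = height (take j m') \<and> height (take (Suc j) m') = height (take j m') + 1)" for x y
  proof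
    assume "(x, y) \<in> A"
    then obtain j i where *: "j \<le> 2 * Suc n" "x = int j - int (Suc n)" "y = height (take j m')"
      "i \<le> 2 * Suc n" "x + 1 = int i - int (Suc n)" "y + 1 = height (take i m')" "s \<le> x"
      unfolding A_def up_starts_def up mem_Collect_eq split tr[OF len'(2)] by blast
    have "i = Suc j" using * by linarith
    with * show "\<exists>j. x = int j - int (Suc n) \<and> k < j \<and> j < 2 * Suc n \<and>
      y = height (take j m') \<and> height (take (Suc j) m') = height (take j m') + 1"
      by (intro exI[of _ j]) (auto simp: sk)
  next
    assume "\<exists>j. x = int j - int (Suc n) \<and> k < j \<and> j < 2 * Suc n \<and>
      y = height (take j m') \<and> height (take (Suc j) m') = height (take j m') + 1"
    then obtain j where j: "x = int j - int (Suc n)" "k < j" "j < 2 * Suc n"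
      "y = height (take j m')" "height (take (Suc j) m') = height (take j m') + 1" by blast
    have "(x, y) \<in> trace (- int (Suc n), 0) m'"
      unfolding tr[OF len'(2)] using j by (intro exI[of _ j]) auto
    moreover have "(x + 1, y + 1) \<in> trace (- int (Suc n), 0) m'"
      unfolding tr[OF len'(2)] using j by (intro exI[of _ "Suc j"]) auto
    ultimately show "(x, y) \<in> A"
      unfolding A_def up_starts_def up mem_Collect_eq split using j by (simp add: sk)
  qed
  have up': "upper (sgrow T s) = trace (- int (Suc n), 0) u'"
  proof -
    have "(x, y) \<in> upper (sgrow T s) \<longleftrightarrow> (x, y) \<in> trace (- int (Suc n), 0) u'" for x y
    proof -
      have 1: "(x, y) \<in> upper (sgrow T s) \<longleftrightarrow>
          (x, y) \<in> trace (- int (Suc n), 0) m' \<and> (x, y) \<notin> A \<or> (x, y - 2) \<in> A"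
      proof -
        have "upper (sgrow T s) =
            (trace (- int (Suc n), 0) m' - A) \<union> {(a, h + 2) | a h. (a, h) \<in> A}"
          unfolding up[symmetric] by (simp add: sgrow_def Let_def spread_tiling_def A_def)
        moreover have "(x, y) \<in> {(a, h + 2) | a h. (a, h) \<in> A} \<longleftrightarrow> (x, y - 2) \<in> A"
          by (auto intro!: exI[of _ "y - 2"])
        ultimately show ?thesis by blast
      qed
      show ?thesis
      proof (cases "- int (Suc n) \<le> x \<and> x \<le> int (Suc n)")
        case True
        define j where "j = nat (x + int (Suc n))"
        have j: "x = int j - int (Suc n)" "j \<le> 2 * Suc n" using True by (auto simp: j_def)
        have trj: "(x, y) \<in> trace (- int (Suc n), 0) w \<longleftrightarrow> y = height (take j w)"
          if "length w = 2 * Suc n" for w y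
          unfolding tr[OF that] using j by auto
        have A': "(x, y) \<in> A \<longleftrightarrow> k < j \<and> j < 2 * Suc n \<and> y = height (take j m') \<and>
            height (take (Suc j) m') = height (take j m') + 1" for y
          unfolding A using j(1) by auto
        show ?thesis unfolding 1 trj[OF len'(2)] trj[OF len'(3)] A' hu[OF j(2)] by auto
      next
        case False
        then show ?thesis unfolding 1 A tr[OF len'(2)] tr[OF len'(3)] by auto
      qed
    qed
    then show ?thesis by auto
  qed
  have lo': "lower (sgrow T s) = trace (- int (Suc n), 0) l'"
    using lo by (simp add: sgrow_def Let_def spread_tiling_def)
  have le: "height (take j l') \<le> height (take j m')" if "j \<le> 2 * Suc n" for j
    using that lm(3) k len unfolding l'_def m'_def height_take_insert[OF k(1)] height_take_insert[OF k(2)]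
    by auto
  have le': "height (take j l') \<le> height (take j u')" if "j \<le> 2 * Suc n" for j
    using le[OF that] hu[OF that] by auto
  have par: "even (height (take j v) - int j)" if "j \<le> length v" for j v
    using that
  proof (induction j)
    case (Suc j)
    then have "even (height (take j v) - int j)" by simp
    then show ?case using step[of j v] Suc.prems by auto
  qed simp
  have shape: "skew_shape (lower (sgrow T s)) (upper (sgrow T s)) =
      spread s (skew_shape (lower T) (upper T)) \<union> A"
    and disj: "spread s (skew_shape (lower T) (upper T)) \<inter> A = {}"
  proof -
    have S: "(x, y) \<in> skew_shape (trace (- int (Suc n), 0) l') (trace (- int (Suc n), 0) w) \<longleftrightarrow>
       (\<exists>j. j \<le> 2 * Suc n \<and> x = int j - int (Suc n) \<and> height (take j l') \<le> y \<and>
          y + 2 \<le> height (take j w) \<and> even (y - height (take j l')))"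
      if "length w = 2 * Suc n" for w x y
      unfolding skew_shape_def mem_Collect_eq split tr[OF len'(1)] tr[OF that] by auto
    have *: "(x, y) \<in> skew_shape (trace (- int (Suc n), 0) l') (trace (- int (Suc n), 0) u') \<longleftrightarrow>
      (x, y) \<in> skew_shape (trace (- int (Suc n), 0) l') (trace (- int (Suc n), 0) m') \<or> (x, y) \<in> A" (is "?L \<longleftrightarrow> ?R")
      and **: "\<not> ((x, y) \<in> skew_shape (trace (- int (Suc n), 0) l') (trace (- int (Suc n), 0) m') \<and> (x, y) \<in> A)"
      for x y
    proof -
      have "?L \<longleftrightarrow> (\<exists>j. j \<le> 2 * Suc n \<and> x = int j - int (Suc n) \<and> height (take j l') \<le> y \<and>
          y + 2 \<le> height (take j u') \<and> even (y - height (take j l')))"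
        by (rule S[OF len'(3)])
      also have "\<dots> \<longleftrightarrow> (\<exists>j. j \<le> 2 * Suc n \<and> x = int j - int (Suc n) \<and>
          (height (take j l') \<le> y \<and> y + 2 \<le> height (take j m') \<and> even (y - height (take j l')) \<or>
           k < j \<and> j < 2 * Suc n \<and> y = height (take j m') \<and>
            height (take (Suc j) m') = height (take j m') + 1))"
      proof (intro ex_cong1 conj_cong refl)
        fix j assume j: "j \<le> 2 * Suc n"
        have "even (height (take j m') - height (take j l'))"
          using par[of j l'] par[of j m'] j len' by fastforce
        then show "(height (take j l') \<le> y \<and> y + 2 \<le> height (take j u') \<and> even (y - height (take j l'))) =
          (height (take j l') \<le> y \<and> y + 2 \<le> height (take j m') \<and> even (y - height (take j l')) \<or>
           k < j \<and> j < 2 * Suc n \<and> y = height (take j m') \<and>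
            height (take (Suc j) m') = height (take j m') + 1)"
          unfolding hu[OF j] using le[OF j]
          by (cases "y = height (take j m')"; cases "y = height (take j m') - 1") auto
      qed
      also have "\<dots> \<longleftrightarrow> ?R"
        unfolding S[OF len'(2)] A using less_imp_le[of _ "2 * Suc n"] by blast
      finally show "?L \<longleftrightarrow> ?R" .
      show "\<not> ((x, y) \<in> skew_shape (trace (- int (Suc n), 0) l') (trace (- int (Suc n), 0) m') \<and> (x, y) \<in> A)"
        unfolding S[OF len'(2)] A by auto
    qed
    show "skew_shape (lower (sgrow T s)) (upper (sgrow T s)) =
      spread s (skew_shape (lower T) (upper T)) \<union> A"
      unfolding lo' up' skew_shape_spread[symmetric] lo up using * by auto
    show "spread s (skew_shape (lower T) (upper T)) \<inter> A = {}"
      unfolding skew_shape_spread[symmetric] lo up using ** by auto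
  qed
  have tiles': "tiles (sgrow T s) = spread s ` tiles T \<union> {{c} | c. c \<in> A}"
    by (simp add: sgrow_def Let_def spread_tiling_def A_def)
  have part': "partition_on (skew_shape (lower (sgrow T s)) (upper (sgrow T s))) (tiles (sgrow T s))"
  proof (rule partition_onI)
    note P = partition_on_spread[OF part, of s]
    have UP: "\<Union>(spread s ` tiles T) = spread s (skew_shape (lower T) (upper T))"
      using P by (simp add: partition_on_def)
    show "\<Union>(tiles (sgrow T s)) = skew_shape (lower (sgrow T s)) (upper (sgrow T s))"
      unfolding tiles' shape Union_Un_distrib UP by auto
    show "{} \<notin> tiles (sgrow T s)" using partition_onD3[OF P] by (auto simp: tiles')
    show "disjnt p q" if "p \<in> tiles (sgrow T s)" "q \<in> tiles (sgrow T s)" "p \<noteq> q" for p q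
    proof -
      have old: "disjnt p q" if "p \<in> spread s ` tiles T" "q \<in> spread s ` tiles T"
        using that \<open>p \<noteq> q\<close> partition_onD2[OF P] by (auto simp: disjnt_def dest: disjointD)
      have mix: "disjnt p {c}" if "p \<in> spread s ` tiles T" "c \<in> A" for p c
        using that UP disj by (auto simp: disjnt_def)
      show ?thesis
        using that old mix unfolding tiles' by (auto simp: disjnt_sym)
    qed
  qed
  have tile': "dyck_tile B" if "B \<in> tiles (sgrow T s)" for B
  proof -
    have "dyck_tile {c}" for c
    proof -
      have "dyck_path 0 []" "{c} = trace (fst c, snd c) []"
        by (cases c; auto simp: dyck_path_def)+
      then show ?thesis unfolding dyck_tile_def by blast
    qed
    then show ?thesis using that tile dyck_tile_spread unfolding tiles' by auto
  qed
  have dp: "dyck_path (Suc n) l'" "dyck_path (Suc n) u'"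
    unfolding l'_def u'_def
    using dyck_path_insert[OF lm(1) k(1)] dyck_path_strip[OF lm(2) k(2)] by simp_all
  show ?thesis
    unfolding dyck_tiling_def using dp le' lo' up' part' tile' by blast
qed

theorem dyck_tiling_DTS:
  assumes "growth_sequence n p"
  shows "dyck_tiling n (DTS p)"
proof -
  have "dyck_tiling i (fold (\<lambda>i T. sgrow T (int (p ! i) - int i)) [0..<i] empty_tiling)"
    if "i \<le> n" for i
    using that
  proof (induction i)
    case 0
    have "skew_shape {(0, 0)} {(0, 0)} = {}" by (auto simp: skew_shape_def)
    then show ?case
      by (auto simp: dyck_tiling_def empty_tiling_def dyck_path_def partition_on_empty)
  next
    case (Suc i)
    have "p ! i \<le> 2 * i" using assms Suc.prems by (simp add: growth_sequence_def)
    then show ?case using Suc by (auto intro!: dyck_tiling_sgrow)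
  qed
  then show ?thesis using assms by (auto simp: DTS_def growth_sequence_def)
qed

end

theory Submission
  imports Defs
begin

text \<open>Both sides grow by the same amount when a growth sequence is extended by an entry \<open>k\<close>.  A spread
  adds two boxes to every tile that meets the chosen column, so strip-growing raises art by the number
  of boxes in that column plus the number of new boxes; this sum is the number of up steps of the lower
  path after position \<open>k\<close>.  On the other side, the new chord carries the largest label, so it forms an
  inversion exactly with the chords whose up steps come after it.\<close>

section \<open>Inserting a peak into a word\<close>

text \<open>The weights in \<open>art\<close> make both kinds of growth equal: a box in the chosen
  column yields two more boxes and no further tile, a new one-box tile yields one box and one tile,
  so each raises \<open>art\<close> by exactly 1. The induction runs along a growth sequence,
  whereas the theorem starts from \<open>w\<close> and \<sigma> and reaches the sequence through a
  definite description; its existence and uniqueness therefore have to be proved. Chords are awkward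
  for this, since an insertion moves both of their ends. An up step determines its chord, so
  labelings are replaced by functions on up step positions, on which an insertion acts by a single
  shift.\<close>

abbreviation insert2 :: "nat \<Rightarrow> 'a \<Rightarrow> 'a \<Rightarrow> 'a list \<Rightarrow> 'a list" where
  "insert2 k a b v \<equiv> take k v @ [a, b] @ drop k v"

definition ups :: "step list \<Rightarrow> nat set" where
  "ups w = {x. x < length w \<and> w ! x = U}"

text \<open>Strictly increasing, and its image omits exactly \<open>k\<close> and
  \<open>Suc k\<close>, the places of the two inserted letters. It is applied to letter positions
  and also to prefix lengths.\<close>

definition shift :: "nat \<Rightarrow> nat \<Rightarrow> nat" where
  "shift k x = (if x < k then x else x + 2)"

lemma finite_ups [simp]: "finite (ups w)"
  by (simp add: ups_def)

lemma shift_less_iff [simp]: "shift k x < shift k y \<longleftrightarrow> x < y"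
  by (auto simp: shift_def)

lemma shift_eq_iff [simp]: "shift k x = shift k y \<longleftrightarrow> x = y"
  by (auto simp: shift_def)

lemma inj_on_shift: "inj_on (shift k) A"
  by (simp add: inj_on_def)

lemma shift_neq [simp]: "shift k x \<noteq> k" "k \<noteq> shift k x"
  by (auto simp: shift_def)

lemma less_shift_iff [simp]: "k < shift k x \<longleftrightarrow> k \<le> x"
  by (auto simp: shift_def)

lemma nth_insert2:
  assumes "k \<le> length v"
  shows "insert2 k a b v ! k = a" "insert2 k a b v ! Suc k = b"
    and "x < length v \<Longrightarrow> insert2 k a b v ! shift k x = v ! x"
proof -
  show "insert2 k a b v ! k = a" "insert2 k a b v ! Suc k = b"
    using assms by (simp_all add: nth_append)
  assume x: "x < length v"
  show "insert2 k a b v ! shift k x = v ! x"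
  proof (cases "x < k")
    case True
    then show ?thesis using assms x by (simp add: shift_def nth_append)
  next
    case False
    then have "x + 2 - k = Suc (Suc (x - k))" by simp
    then show ?thesis using assms x False by (simp add: shift_def nth_append)
  qed
qed

lemma shift_cases:
  obtains "x = k" | "x = Suc k" | y where "x = shift k y"
proof -
  have "x = k \<or> x = Suc k \<or> x = shift k (if x < k then x else x - 2)"
    by (auto simp: shift_def)
  then show ?thesis using that by blast
qed

lemma ups_insert2:
  assumes "k \<le> length w"
  shows "ups (insert2 k U D w) = insert k (shift k ` ups w)"
proof -
  have "x \<in> ups (insert2 k U D w) \<longleftrightarrow> x \<in> insert k (shift k ` ups w)" for x
  proof (cases rule: shift_cases[of x k])
    case 1
    then show ?thesis using assms nth_insert2(1)[OF assms, of U D] by (auto simp: ups_def)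
  next
    case 2
    have "Suc k \<noteq> shift k y" for y by (auto simp: shift_def)
    then show ?thesis using 2 assms nth_insert2(2)[OF assms, of U D] by (auto simp: ups_def)
  next
    case (3 y)
    have "shift k y < length w + 2 \<longleftrightarrow> y < length w" using assms by (auto simp: shift_def)
    then show ?thesis using 3 assms nth_insert2(3)[OF assms, of y U D] by (auto simp: ups_def)
  qed
  then show ?thesis by blast
qed

text \<open>A prefix that ends at the insertion point may stop before the new peak or after it, at
  the same height; \<open>shift\<close> chooses the latter, as it sends \<open>k\<close> to
  \<open>k + 2\<close>.\<close>

lemma height_take_shift:
  assumes "k \<le> length w"
  shows "height (take (shift k j) (insert2 k U D w)) = height (take j w)"
  unfolding height_take_insert[OF assms] by (auto simp: shift_def)

lemma insert2_eq_iff: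
  assumes "k \<le> length v" "k \<le> length v'"
  shows "insert2 k a b v = insert2 k a b v' \<longleftrightarrow> v = v'"
proof
  assume "insert2 k a b v = insert2 k a b v'"
  then have "take k v = take k v'" "drop k v = drop k v'"
    using assms by (auto simp: append_eq_append_conv)
  then show "v = v'" by (metis append_take_drop_id)
qed simp

section \<open>Heights, up steps and chords\<close>

lemma height_take_Suc:
  "j < length w \<Longrightarrow>
    height (take (Suc j) w) = (if w ! j = U then height (take j w) + 1 else height (take j w) - 1)"
  by (cases "w ! j") (auto simp: take_Suc_conv_app_nth)

text \<open>Up steps plus down steps make the length, up steps minus down steps the height. Doubling
  avoids a division.\<close>

lemma double_card_ups: "2 * int (card (ups w)) = int (length w) + height w"
proof -
  have "2 * int (length (filter (\<lambda>s. s = U) w)) = int (length w) + height w"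
  proof (induction w)
    case (Cons a w)
    then show ?case by (cases a) auto
  qed simp
  then show ?thesis by (simp add: length_filter_conv_card ups_def)
qed

lemma even_height_diff_length: "even (height w - int (length w))"
  using double_card_ups[of w] by presburger

text \<open>The count of all up steps, applied to the suffix after \<open>k\<close>. It turns counts
  of up steps into heights, so that the lower and the upper path can be compared at a single
  column.\<close>

lemma double_card_ups_ge:
  assumes "k \<le> length w"
  shows "2 * int (card {x \<in> ups w. k \<le> x}) = int (length w) - int k + height w - height (take k w)"
proof -
  have "{x \<in> ups w. k \<le> x} = (+) k ` ups (drop k w)"
  proof (intro set_eqI iffI)
    fix x assume "x \<in> {x \<in> ups w. k \<le> x}"
    then have "x - k \<in> ups (drop k w)" "x = k + (x - k)" by (auto simp: ups_def)
    then show "x \<in> (+) k ` ups (drop k w)" by blast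
  qed (auto simp: ups_def)
  then have "card {x \<in> ups w. k \<le> x} = card (ups (drop k w))"
    by (simp add: card_image)
  moreover have "height w = height (take k w) + height (drop k w)"
    by (metis append_take_drop_id height_simps(4))
  ultimately show ?thesis using double_card_ups[of "drop k w"] assms by simp
qed

text \<open>Replaces the balanced factor between the two steps by conditions on prefix heights of
  the whole word, which are easy to follow through an insertion.\<close>

lemma mem_chords_iff:
  "(i, j) \<in> chords w \<longleftrightarrow> i < j \<and> j < length w \<and> w ! i = U \<and> w ! j = D \<and>
     height (take j w) = height (take (Suc i) w) \<and>
     (\<forall>m. Suc i \<le> m \<and> m \<le> j \<longrightarrow> height (take (Suc i) w) \<le> height (take m w))"
proof (cases "i < j \<and> j < length w")
  case True
  define v where "v = take (j - Suc i) (drop (Suc i) w)"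
  have len: "length v = j - Suc i" using True by (auto simp: v_def)
  have H: "height (take t v) = height (take (Suc i + t) w) - height (take (Suc i) w)"
    if "t \<le> j - Suc i" for t
    using that unfolding v_def take_add by (simp add: min_absorb1)
  have Hv: "height v = height (take j w) - height (take (Suc i) w)"
    using H[of "j - Suc i"] True len by simp
  have "(\<exists>m. dyck_path m v) \<longleftrightarrow> height v = 0 \<and> (\<forall>t\<le>length v. 0 \<le> height (take t v))"
  proof
    assume R: "height v = 0 \<and> (\<forall>t\<le>length v. 0 \<le> height (take t v))"
    \<comment> \<open>\<open>dyck_path\<close> also asks for an even length. This follows from
      height 0 and supplies the order.\<close>
    then have "even (length v)" using even_height_diff_length[of v] by simp
    then show "\<exists>m. dyck_path m v" using R by (auto simp: dyck_path_def elim!: evenE)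
  qed (auto simp: dyck_path_def)
  also have "(\<forall>t\<le>length v. 0 \<le> height (take t v)) \<longleftrightarrow>
      (\<forall>m. Suc i \<le> m \<and> m \<le> j \<longrightarrow> height (take (Suc i) w) \<le> height (take m w))"
  proof (intro iffI allI impI)
    fix m assume *: "\<forall>t\<le>length v. 0 \<le> height (take t v)" "Suc i \<le> m \<and> m \<le> j"
    have "m - Suc i \<le> j - Suc i" using *(2) by (simp add: diff_le_mono)
    moreover from this have "0 \<le> height (take (m - Suc i) v)" using *(1) len by simp
    ultimately
    show "height (take (Suc i) w) \<le> height (take m w)" using H[of "m - Suc i"] *(2) by simp
  next
    fix t assume *: "\<forall>m. Suc i \<le> m \<and> m \<le> j \<longrightarrow> height (take (Suc i) w) \<le> height (take m w)"
      "t \<le> length v"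
    moreover have "Suc i + t \<le> j" using *(2) len True by linarith
    ultimately have "height (take (Suc i) w) \<le> height (take (Suc i + t) w)" by simp
    then show "0 \<le> height (take t v)" using H[of t] * len by simp
  qed
  finally show ?thesis using True Hv unfolding chords_def v_def by auto
qed (auto simp: chords_def)

text \<open>The partner of an up step is the first later step that takes the path below the height
  reached by that up step.\<close>

lemma bij_betw_fst_chords:
  assumes "dyck_path n w"
  shows "bij_betw fst (chords w) (ups w)"
proof (rule bij_betw_imageI)
  \<comment> \<open>After \<open>j\<close> the path is one below the level of the chord, which the
    longer chord ending at \<open>j'\<close> forbids.\<close>
  have less: False if "(i, j) \<in> chords w" "(i, j') \<in> chords w" "j < j'" for i j j'
  proof -
    have "height (take (Suc i) w) \<le> height (take (Suc j) w)"
      using that unfolding mem_chords_iff by auto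
    then show False using that height_take_Suc[of j w] unfolding mem_chords_iff by auto
  qed
  show "inj_on fst (chords w)"
    by (rule inj_onI) (metis less linorder_neqE_nat prod.collapse)
  have "x \<in> fst ` chords w" if x: "x \<in> ups w" for x
  proof -
    \<comment> \<open>\<open>P j\<close> says that the path has dropped below its height after
      \<open>x\<close> once step \<open>j\<close> is done. The last step qualifies, because that
      height is at least 1 and the path ends at 0; the least such \<open>j\<close> is the partner of
      \<open>x\<close>.\<close>
    define P where "P j \<longleftrightarrow> x < j \<and> j < length w \<and> height (take (Suc j) w) < height (take (Suc x) w)" for j
    have xl: "x < length w" "w ! x = U" using x by (auto simp: ups_def)
    have Hx: "height (take (Suc x) w) \<ge> 1"
      using assms xl height_take_Suc[OF xl(1)] by (auto simp: dyck_path_def)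
    have "x \<noteq> length w - 1"
      using Hx xl assms by (auto simp: dyck_path_def)
    then have "P (length w - 1)"
      using Hx xl assms by (auto simp: P_def dyck_path_def)
    then have Pj: "P (Least P)" by (rule LeastI)
    define j where "j = Least P"
    have j: "x < j" "j < length w" "height (take (Suc j) w) < height (take (Suc x) w)"
      using Pj by (auto simp: P_def j_def)
    have ge: "height (take (Suc x) w) \<le> height (take m w)" if "Suc x \<le> m" "m \<le> j" for m
    proof (cases "m = Suc x")
      case False
      then have "m - 1 < j" "Suc (m - 1) = m" "x < m - 1" using that by auto
      moreover from this have "\<not> P (m - 1)" using not_less_Least j_def by blast
      ultimately show ?thesis using j(2) by (simp add: P_def)
    qed simp
    have "w ! j = D \<and> height (take j w) = height (take (Suc x) w)"
      using ge[of j] j height_take_Suc[OF j(2)] by (cases "w ! j") auto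
    then have "(x, j) \<in> chords w" using j xl ge by (auto simp: mem_chords_iff)
    then show ?thesis by force
  qed
  then show "fst ` chords w = ups w" by (auto simp: chords_def ups_def)
qed

text \<open>A peak inserted inside a chord only adds prefixes of heights
  \<open>height (take k w)\<close> and one more, so the path still does not dip below the level of
  the chord.\<close>

lemma chords_insert2:
  assumes k: "k \<le> length w" and c: "(i, j) \<in> chords w"
  shows "(shift k i, shift k j) \<in> chords (insert2 k U D w)"
proof -
  let ?w = "insert2 k U D w"
  have ij: "i < j" "j < length w" "w ! i = U" "w ! j = D"
      "height (take j w) = height (take (Suc i) w)"
    and ge: "\<And>m. Suc i \<le> m \<Longrightarrow> m \<le> j \<Longrightarrow> height (take (Suc i) w) \<le> height (take m w)"
    using c by (auto simp: mem_chords_iff)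
  \<comment> \<open>\<open>Suc (shift k i)\<close> differs from \<open>shift k (Suc i)\<close> when
    \<open>Suc i = k\<close>: the former stops before the peak, the latter after it. So
    \<open>height_take_shift\<close> does not apply here.\<close>
  have S: "height (take (Suc (shift k i)) ?w) = height (take (Suc i) w)"
    using height_take_insert[OF k] by (auto simp: shift_def)
  have "height (take (Suc i) w) \<le> height (take m ?w)"
    if m: "Suc (shift k i) \<le> m" "m \<le> shift k j" for m
  proof (cases rule: shift_cases[of m k])
    case 1
    then have "Suc i \<le> k" "k \<le> j" using m by (auto simp: shift_def split: if_splits)
    then show ?thesis using 1 ge[of k] height_take_insert[OF k, of m] by simp
  next
    case 2
    then have "Suc i \<le> k" "k \<le> j" using m by (auto simp: shift_def split: if_splits)
    then show ?thesis using 2 ge[of k] height_take_insert[OF k, of m] by simp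
  next
    case (3 y)
    then have "Suc i \<le> y" "y \<le> j" using m by (auto simp: shift_def split: if_splits)
    then show ?thesis using 3 ge[of y] height_take_shift[OF k, of y] by simp
  qed
  moreover have "shift k j < length ?w" using ij k by (auto simp: shift_def)
  ultimately show ?thesis
    unfolding mem_chords_iff S using ij height_take_shift[OF k, of j]
      nth_insert2(3)[OF k, of i U D] nth_insert2(3)[OF k, of j U D] by auto
qed

section \<open>Growth sequences\<close>

lemma growth_sequence_0: "growth_sequence 0 p \<longleftrightarrow> p = []"
  by (auto simp: growth_sequence_def)

lemma growth_sequence_snoc:
  "growth_sequence (Suc n) (p @ [k]) \<longleftrightarrow> growth_sequence n p \<and> k \<le> 2 * n"
  by (auto simp: growth_sequence_def nth_append less_Suc_eq)

lemma growth_sequence_SucE: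
  assumes "growth_sequence (Suc n) p"
  obtains q k where "p = q @ [k]" "growth_sequence n q" "k \<le> 2 * n"
proof -
  have "p \<noteq> []" using assms by (auto simp: growth_sequence_def)
  then obtain q k where "p = q @ [k]" by (metis append_butlast_last_id)
  then show ?thesis using that assms growth_sequence_snoc by blast
qed

lemma grow_snoc:
  assumes "length p = n"
  shows "grow (p @ [k]) = insert2 k (U, Suc n) (D, Suc n) (grow p)"
proof -
  have "fold (\<lambda>i v. insert2 ((p @ [k]) ! i) (U, Suc i) (D, Suc i) v) [0..<n] [] =
      fold (\<lambda>i v. insert2 (p ! i) (U, Suc i) (D, Suc i) v) [0..<n] []"
    by (rule fold_cong) (use assms in \<open>auto simp: nth_append\<close>)
  then show ?thesis using assms by (simp add: grow_def nth_append)
qed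

lemma DTS_snoc:
  assumes "length p = n"
  shows "DTS (p @ [k]) = sgrow (DTS p) (int k - int n)"
proof -
  have "fold (\<lambda>i T. sgrow T (int ((p @ [k]) ! i) - int i)) [0..<n] empty_tiling =
      fold (\<lambda>i T. sgrow T (int (p ! i) - int i)) [0..<n] empty_tiling"
    by (rule fold_cong) (use assms in \<open>auto simp: nth_append\<close>)
  then show ?thesis using assms by (simp add: DTS_def nth_append)
qed

lemma length_grow: "length (grow p) = 2 * length p"
proof (induction p rule: rev_induct)
  case (snoc k p)
  have "length (take k v) + length (drop k v) = length v" for v :: "(step \<times> nat) list"
    by (metis append_take_drop_id length_append)
  then show ?case using snoc by (simp add: grow_snoc)
qed (simp add: grow_def)

lemma length_grown_path: "length (grown_path p) = 2 * length p"
  by (simp add: grown_path_def length_grow)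

lemma grown_path_snoc: "grown_path (p @ [k]) = insert2 k U D (grown_path p)"
  by (simp add: grown_path_def grow_snoc take_map drop_map)

lemma dyck_path_grown_path: "growth_sequence n p \<Longrightarrow> dyck_path n (grown_path p)"
proof (induction n arbitrary: p)
  case 0
  then show ?case by (simp add: growth_sequence_0 grown_path_def grow_def dyck_path_def)
next
  case (Suc n)
  then obtain q k where q: "p = q @ [k]" "growth_sequence n q" "k \<le> 2 * n"
    by (blast elim: growth_sequence_SucE)
  then have "k \<le> length (grown_path q)" by (simp add: length_grown_path growth_sequence_def)
  then show ?case using Suc.IH[OF q(2)] dyck_path_insert unfolding q(1) grown_path_snoc by blast
qed

lemma label_snoc:
  assumes "growth_sequence n p" "k \<le> 2 * n"
  shows "snd (grow (p @ [k]) ! k) = Suc n"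
    and "x \<in> ups (grown_path p) \<Longrightarrow> snd (grow (p @ [k]) ! shift k x) = snd (grow p ! x)"
    and "ups (grown_path (p @ [k])) = insert k (shift k ` ups (grown_path p))"
proof -
  have n: "length p = n" using assms by (simp add: growth_sequence_def)
  have k: "k \<le> length (grow p)" "k \<le> length (grown_path p)"
    using assms n by (simp_all add: length_grow length_grown_path)
  show "snd (grow (p @ [k]) ! k) = Suc n"
    unfolding grow_snoc[OF n] nth_insert2(1)[OF k(1)] by simp
  show "snd (grow (p @ [k]) ! shift k x) = snd (grow p ! x)" if "x \<in> ups (grown_path p)"
  proof -
    have "x < length (grow p)" using that by (simp add: ups_def grown_path_def)
    then show ?thesis unfolding grow_snoc[OF n] by (subst nth_insert2(3)[OF k(1)]) simp_all
  qed
  show "ups (grown_path (p @ [k])) = insert k (shift k ` ups (grown_path p))"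
    unfolding grown_path_snoc by (rule ups_insert2[OF k(2)])
qed

text \<open>The domain consists of up steps only, because both letters of a chord carry its label
  and over all positions the labels would repeat.\<close>

lemma bij_betw_label:
  "growth_sequence n p \<Longrightarrow> bij_betw (\<lambda>x. snd (grow p ! x)) (ups (grown_path p)) {1..n}"
proof (induction n arbitrary: p)
  case 0
  then show ?case by (simp add: growth_sequence_0 grown_path_def grow_def ups_def bij_betw_def)
next
  case (Suc n)
  then obtain q k where q: "p = q @ [k]" "growth_sequence n q" "k \<le> 2 * n"
    by (blast elim: growth_sequence_SucE)
  note l = label_snoc[OF q(2,3)]
  let ?W = "ups (grown_path q)" and ?f = "\<lambda>x. snd (grow p ! x)"
  have b: "bij_betw (\<lambda>x. snd (grow q ! x)) ?W {1..n}" by (rule Suc.IH[OF q(2)])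
  have "bij_betw (?f \<circ> shift k) ?W {1..n}"
    by (rule bij_betw_cong[THEN iffD1, OF _ b]) (simp add: q(1) l(2))
  then have "bij_betw ?f (shift k ` ?W) {1..n}"
    by (simp add: bij_betw_comp_iff[OF inj_on_imp_bij_betw[OF inj_on_shift]])
  then have "bij_betw ?f (shift k ` ?W \<union> {k}) ({1..n} \<union> {Suc n})"
    by (rule bij_betw_combine) (auto simp: bij_betw_def q(1) l(1))
  moreover have "{1..n} \<union> {Suc n} = {1..Suc n}" by auto
  ultimately show ?case by (simp add: q(1) l(3))
qed

text \<open>The last entry can be read off as the position of the up step with the largest label.
  Removing that peak leaves the shorter sequence to the induction hypothesis.\<close>

lemma growth_sequence_unique:
  assumes "growth_sequence n p" "growth_sequence n p'" "grown_path p = grown_path p'"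
    and "\<And>x. x \<in> ups (grown_path p) \<Longrightarrow> snd (grow p ! x) = snd (grow p' ! x)"
  shows "p = p'"
  using assms
proof (induction n arbitrary: p p')
  case 0
  then show ?case by (simp add: growth_sequence_0)
next
  case (Suc n)
  obtain q k where q: "p = q @ [k]" "growth_sequence n q" "k \<le> 2 * n"
    using Suc.prems(1) by (blast elim: growth_sequence_SucE)
  obtain q' k' where q': "p' = q' @ [k']" "growth_sequence n q'" "k' \<le> 2 * n"
    using Suc.prems(2) by (blast elim: growth_sequence_SucE)
  note l = label_snoc[OF q(2,3), folded q(1)] and l' = label_snoc[OF q'(2,3), folded q'(1)]
  \<comment> \<open>Both \<open>k\<close> and \<open>k'\<close> are positions of the label
    \<open>Suc n\<close> on the same path, where labels are injective.\<close>
  have "k \<in> ups (grown_path p)" "k' \<in> ups (grown_path p)"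
    using l(3) l'(3) Suc.prems(3) by auto
  moreover have "snd (grow p ! k) = snd (grow p ! k')"
    using l(1) l'(1) Suc.prems(4)[OF calculation(2)] by simp
  ultimately have k: "k' = k"
    using bij_betw_label[OF Suc.prems(1)] by (auto simp: bij_betw_def dest: inj_onD)
  have path: "grown_path q = grown_path q'"
  proof -
    have "insert2 k U D (grown_path q) = insert2 k U D (grown_path q')"
      using Suc.prems(3) unfolding q(1) q'(1) k grown_path_snoc .
    then show ?thesis
      by (subst (asm) insert2_eq_iff)
        (use q q' in \<open>auto simp: length_grown_path growth_sequence_def\<close>)
  qed
  have "snd (grow q ! x) = snd (grow q' ! x)" if x: "x \<in> ups (grown_path q)" for x
  proof -
    have "shift k x \<in> ups (grown_path p)" using x l(3) by simp
    then show ?thesis using Suc.prems(4)[of "shift k x"] l(2)[OF x] l'(2)[of x] x path k by simp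
  qed
  then show ?case using Suc.IH[OF q(2) q'(2) path] q(1) q'(1) k by simp
qed

text \<open>The chord with the largest label has nothing nested inside it, so it is a peak that can be
  removed.\<close>

lemma growth_sequence_exists:
  assumes "dyck_path n w" "bij_betw f (ups w) {1..n}"
    and "\<And>c c'. c \<in> chords w \<Longrightarrow> c' \<in> chords w \<Longrightarrow> chord_less c c' \<Longrightarrow> f (fst c) < f (fst c')"
  shows "\<exists>p. growth_sequence n p \<and> grown_path p = w \<and> (\<forall>x\<in>ups w. snd (grow p ! x) = f x)"
  using assms
proof (induction n arbitrary: w f)
  case 0
  then show ?case
    by (intro exI[of _ "[]"])
      (simp add: growth_sequence_0 grown_path_def grow_def ups_def dyck_path_def)
next
  case (Suc n)
  have "Suc n \<in> f ` ups w" using Suc.prems(2) by (simp add: bij_betw_def)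
  then obtain k where k: "k \<in> ups w" "f k = Suc n" by auto
  have f_le: "f x \<le> Suc n" if "x \<in> ups w" for x
    using that Suc.prems(2) by (auto simp: bij_betw_def)
  have fst_chords: "fst ` chords w = ups w"
    using bij_betw_fst_chords[OF Suc.prems(1)] by (simp add: bij_betw_def)
  with k(1) obtain j where j: "(k, j) \<in> chords w" by force
  note j' = j[unfolded mem_chords_iff]
  \<comment> \<open>Otherwise the letter after \<open>k\<close> cannot be a down step, as the path
    would fall below the level of the chord. So it opens a chord nested inside, whose label would
    have to exceed the maximum \<open>Suc n\<close>.\<close>
  have "j = Suc k"
  proof (rule ccontr)
    assume "j \<noteq> Suc k"
    then have kj: "Suc k < j" using j' by auto
    have "height (take (Suc k) w) \<le> height (take (Suc (Suc k)) w)" using j' kj by auto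
    then have H: "w ! Suc k = U" "height (take (Suc (Suc k)) w) = height (take (Suc k) w) + 1"
      using height_take_Suc[of "Suc k" w] kj j' by (auto split: if_splits)
    then have up: "Suc k \<in> ups w" using kj j' by (auto simp: ups_def)
    then obtain i where i: "(Suc k, i) \<in> chords w" using fst_chords by force
    have "i < j"
    proof (rule ccontr)
      assume "\<not> i < j"
      then have "height (take (Suc (Suc k)) w) \<le> height (take j w)"
        using i kj unfolding mem_chords_iff by auto
      then show False using H j' by auto
    qed
    then have "f k < f (Suc k)"
      using Suc.prems(3)[OF j i] by (simp add: chord_less_def)
    then show False using f_le[OF up] k(2) by simp
  qed
  then have wk: "Suc k < length w" "w ! k = U" "w ! Suc k = D" using j' by auto
  define v where "v = take k w @ drop (Suc (Suc k)) w"
  have len: "length w = 2 * Suc n" using Suc.prems(1) by (simp add: dyck_path_def)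
  have lenv: "length v = 2 * n" and kv: "k \<le> length v" using wk len by (auto simp: v_def)
  have w: "w = insert2 k U D v"
  proof -
    have "w = take k w @ w ! k # w ! Suc k # drop (Suc (Suc k)) w"
      by (subst Cons_nth_drop_Suc[OF wk(1)], subst Cons_nth_drop_Suc) (use wk(1) in simp_all)
    then show ?thesis using wk by (simp add: v_def)
  qed
  have Hv: "height (take (shift k i) w) = height (take i v)" for i
    unfolding w by (rule height_take_shift[OF kv])
  have "0 \<le> height (take i v)" for i
    using Hv[of i] Suc.prems(1)
    by (cases "shift k i \<le> length w") (auto simp: dyck_path_def)
  moreover have "height v = 0"
  proof -
    \<comment> \<open>This includes the case \<open>k = length v\<close>, since \<open>shift\<close>
      moves \<open>k\<close> itself.\<close>
    have "shift k (length v) = length w" using kv lenv len by (simp add: shift_def)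
    then show ?thesis using Hv[of "length v"] Suc.prems(1) by (simp add: dyck_path_def)
  qed
  ultimately have dv: "dyck_path n v" using lenv by (simp add: dyck_path_def)
  have ups: "ups w = insert k (shift k ` ups v)" unfolding w by (rule ups_insert2[OF kv])
  have "bij_betw (f \<circ> shift k) (ups v) {1..n}"
  proof -
    have "bij_betw f (ups w - {k}) ({1..Suc n} - {f k})"
      by (rule bij_betw_subset[OF Suc.prems(2)])
        (use Suc.prems(2) k(1) in \<open>auto simp: bij_betw_def dest: inj_onD\<close>)
    moreover have "ups w - {k} = shift k ` ups v" using ups by auto
    moreover have "{1..Suc n} - {f k} = {1..n}" using k(2) by auto
    ultimately have "bij_betw f (shift k ` ups v) {1..n}" by simp
    then show ?thesis
      by (simp add: bij_betw_comp_iff[OF inj_on_imp_bij_betw[OF inj_on_shift]])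
  qed
  moreover have "(f \<circ> shift k) (fst c) < (f \<circ> shift k) (fst c')"
    if c: "c \<in> chords v" "c' \<in> chords v" "chord_less c c'" for c c'
  proof -
    have "(shift k (fst c), shift k (snd c)) \<in> chords w" "(shift k (fst c'), shift k (snd c')) \<in> chords w"
      unfolding w using c chords_insert2[OF kv] by simp_all
    then show ?thesis using Suc.prems(3) c(3) by (fastforce simp: chord_less_def)
  qed
  ultimately obtain q where q: "growth_sequence n q" "grown_path q = v"
      "\<forall>x\<in>ups v. snd (grow q ! x) = (f \<circ> shift k) x"
    using Suc.IH[OF dv] by blast
  have kn: "k \<le> 2 * n" using kv lenv by simp
  show ?case
  proof (intro exI[of _ "q @ [k]"] conjI ballI)
    show "growth_sequence (Suc n) (q @ [k])" using q(1) kn by (simp add: growth_sequence_snoc)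
    show "grown_path (q @ [k]) = w" unfolding grown_path_snoc q(2) w ..
    show "snd (grow (q @ [k]) ! x) = f x" if "x \<in> ups w" for x
      using that label_snoc(1,2)[OF q(1) kn] q(2,3) k(2) unfolding ups by auto
  qed
qed

section \<open>The permutation of a labeling and its inversions\<close>

lemma L0_eq_card_ups:
  assumes "dyck_path n w"
  shows "L0 w c = card {x \<in> ups w. x \<le> fst c}"
proof -
  have b: "inj_on fst (chords w)" "fst ` chords w = ups w"
    using bij_betw_fst_chords[OF assms] by (auto simp: bij_betw_def)
  have "card (fst ` {c' \<in> chords w. fst c' \<le> fst c}) = card {c' \<in> chords w. fst c' \<le> fst c}"
    by (rule card_image) (use b in \<open>auto simp: inj_on_def\<close>)
  moreover have "fst ` {c' \<in> chords w. fst c' \<le> fst c} = {x \<in> ups w. x \<le> fst c}"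
    unfolding b(2)[symmetric] by blast
  ultimately show ?thesis by (simp add: L0_def)
qed

text \<open>Expresses \<sigma> through positions. As \<open>L\<close> factors through
  \<open>fst\<close> on chords and \<open>f\<close> is injective, the inverse of \<open>L\<close> at
  \<open>f x\<close> is the one chord that opens at \<open>x\<close>, and \<open>L0\<close> of that
  chord is the rank of \<open>x\<close>.\<close>

lemma perm_of_label:
  assumes w: "dyck_path n w" and f: "bij_betw f (ups w) {1..n}"
    and L: "\<And>c. c \<in> chords w \<Longrightarrow> L c = f (fst c)" and x: "x \<in> ups w"
  shows "perm_of n w L (f x) = card {y \<in> ups w. y \<le> x}"
proof -
  have b: "bij_betw fst (chords w) (ups w)" by (rule bij_betw_fst_chords[OF w])
  have "x \<in> fst ` chords w" using b x by (simp add: bij_betw_def)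
  then obtain c where c: "c \<in> chords w" "fst c = x" by blast
  have "bij_betw (f \<circ> fst) (chords w) {1..n}" using b f by (rule bij_betw_trans)
  then have "inj_on L (chords w)" using L by (auto simp: bij_betw_def inj_on_def)
  then have "inv_into (chords w) L (L c) = c" using c(1) by simp
  moreover have "f x \<in> {1..n}" using f x by (auto simp: bij_betw_def)
  ultimately show ?thesis using L[OF c(1)] c(2) by (simp add: perm_of_def L0_eq_card_ups[OF w])
qed

lemma card_le_less_iff:
  fixes A :: "nat set"
  assumes "finite A" "x \<in> A" "y \<in> A"
  shows "card {z \<in> A. z \<le> x} < card {z \<in> A. z \<le> y} \<longleftrightarrow> x < y"
proof
  assume "x < y"
  then have "y \<in> {z \<in> A. z \<le> y} - {z \<in> A. z \<le> x}" "{z \<in> A. z \<le> x} \<subseteq> {z \<in> A. z \<le> y}"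
    using assms by auto
  then have "{z \<in> A. z \<le> x} \<subset> {z \<in> A. z \<le> y}" by blast
  then show "card {z \<in> A. z \<le> x} < card {z \<in> A. z \<le> y}" using assms(1) by (simp add: psubset_card_mono)
next
  assume *: "card {z \<in> A. z \<le> x} < card {z \<in> A. z \<le> y}"
  show "x < y"
  proof (rule ccontr)
    assume "\<not> x < y"
    then have "card {z \<in> A. z \<le> y} \<le> card {z \<in> A. z \<le> x}"
      using assms(1) by (intro card_mono) auto
    then show False using * by simp
  qed
qed

text \<open>The up step \<open>y\<close> to which \<open>f'\<close> gives the label
  \<open>f x\<close> has the same rank as \<open>x\<close>; ranks are strictly increasing along the
  path, hence \<open>y = x\<close>.\<close>

lemma perm_of_label_inj:
  assumes w: "dyck_path n w"
    and f: "bij_betw f (ups w) {1..n}" "\<And>c. c \<in> chords w \<Longrightarrow> L c = f (fst c)"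
    and f': "bij_betw f' (ups w) {1..n}" "\<And>c. c \<in> chords w \<Longrightarrow> L' c = f' (fst c)"
    and eq: "perm_of n w L = perm_of n w L'" and x: "x \<in> ups w"
  shows "f x = f' x"
proof -
  have "f x \<in> f' ` ups w" using f(1) f'(1) x by (auto simp: bij_betw_def)
  then obtain y where y: "y \<in> ups w" "f x = f' y" by auto
  have "card {z \<in> ups w. z \<le> x} = card {z \<in> ups w. z \<le> y}"
    using perm_of_label[OF w f x] perm_of_label[OF w f' y(1)] eq y(2) by simp
  then have "x = y"
    using card_le_less_iff[of "ups w" x y] card_le_less_iff[of "ups w" y x] x y(1) by simp
  then show ?thesis using y(2) by simp
qed

text \<open>With \<open>f\<close> the labels, these are the inversions of the inverse of \<sigma>,
  with places written as positions in the word instead of ranks. Unlike ranks, labels of old chords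
  do not change under an insertion.\<close>

definition inverted_ups :: "step list \<Rightarrow> (nat \<Rightarrow> nat) \<Rightarrow> (nat \<times> nat) set" where
  "inverted_ups w f = {(x, y). x \<in> ups w \<and> y \<in> ups w \<and> x < y \<and> f y < f x}"

lemma finite_inverted_ups: "finite (inverted_ups w f)"
  by (rule finite_subset[of _ "ups w \<times> ups w"]) (auto simp: inverted_ups_def)

lemma inversions_perm_of:
  assumes w: "dyck_path n w" and f: "bij_betw f (ups w) {1..n}"
    and L: "\<And>c. c \<in> chords w \<Longrightarrow> L c = f (fst c)"
  shows "inversions n (perm_of n w L) = card (inverted_ups w f)"
proof -
  have fi: "f ` ups w = {1..n}" "inj_on f (ups w)" using f by (auto simp: bij_betw_def)
  have rank: "perm_of n w L (f x) < perm_of n w L (f y) \<longleftrightarrow> x < y" if "x \<in> ups w" "y \<in> ups w" for x y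
  proof -
    have "perm_of n w L (f z) = card {y \<in> ups w. y \<le> z}" if "z \<in> ups w" for z
      by (rule perm_of_label[OF w f _ that]) (rule L)
    then show ?thesis using that by (simp add: card_le_less_iff)
  qed
  \<comment> \<open>Passing to the inverse permutation exchanges places and values, hence the
    swapped coordinates.\<close>
  have "{(i, j). i \<in> {1..n} \<and> j \<in> {1..n} \<and> i < j \<and> perm_of n w L i > perm_of n w L j} =
      (\<lambda>(x, y). (f y, f x)) ` inverted_ups w f" (is "?L = ?R")
  proof (intro set_eqI iffI)
    fix z assume z: "z \<in> ?L"
    then obtain x y where "z = (f y, f x)" "x \<in> ups w" "y \<in> ups w"
      unfolding fi(1)[symmetric] by blast
    then have "(x, y) \<in> inverted_ups w f" "z = (f y, f x)"
      using z rank[of x y] by (auto simp: inverted_ups_def)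
    then show "z \<in> ?R" by force
  next
    fix z assume "z \<in> ?R"
    then show "z \<in> ?L" unfolding fi(1)[symmetric] using rank by (auto simp: inverted_ups_def)
  qed
  moreover have "inj_on (\<lambda>(x, y). (f y, f x)) (inverted_ups w f)"
    using fi(2) by (auto simp: inverted_ups_def inj_on_def)
  ultimately show ?thesis unfolding inversions_def by (simp add: card_image)
qed

lemma card_inverted_ups_snoc:
  assumes p: "growth_sequence n p" "k \<le> 2 * n"
  shows "card (inverted_ups (grown_path (p @ [k])) (\<lambda>x. snd (grow (p @ [k]) ! x))) =
    card (inverted_ups (grown_path p) (\<lambda>x. snd (grow p ! x))) + card {x \<in> ups (grown_path p). k \<le> x}"
proof -
  note l = label_snoc[OF p]
  let ?I = "inverted_ups (grown_path p) (\<lambda>x. snd (grow p ! x))"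
  let ?B = "{x \<in> ups (grown_path p). k \<le> x}"
  have le: "snd (grow p ! x) < Suc n" if "x \<in> ups (grown_path p)" for x
    using bij_betw_label[OF p(1)] that by (auto simp: bij_betw_def less_Suc_eq_le)
  have "inverted_ups (grown_path (p @ [k])) (\<lambda>x. snd (grow (p @ [k]) ! x)) =
      map_prod (shift k) (shift k) ` ?I \<union> (\<lambda>x. (k, shift k x)) ` ?B" (is "?L = ?R")
  proof (intro set_eqI iffI)
    fix z assume z: "z \<in> ?L"
    obtain x y where xy: "z = (x, y)" by (cases z)
    have *: "x \<in> insert k (shift k ` ups (grown_path p))" "y \<in> insert k (shift k ` ups (grown_path p))"
      "x < y" "snd (grow (p @ [k]) ! y) < snd (grow (p @ [k]) ! x)"
      using z unfolding inverted_ups_def l(3) xy by auto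
    \<comment> \<open>The new up step cannot be the right member of an inverted pair, as no label
      exceeds its own.\<close>
    have "y \<noteq> k"
    proof
      assume y: "y = k"
      then obtain x' where "x' \<in> ups (grown_path p)" "x = shift k x'" using *(1,3) by auto
      then show False using *(4) l(1) l(2) le y by (metis less_asym)
    qed
    then obtain y' where y': "y' \<in> ups (grown_path p)" "y = shift k y'" using *(2) by auto
    show "z \<in> ?R"
    proof (cases "x = k")
      case True
      then show ?thesis using y' *(3) xy by auto
    next
      case False
      then obtain x' where x': "x' \<in> ups (grown_path p)" "x = shift k x'" using *(1) by auto
      have "(x', y') \<in> ?I" using x' y' *(3,4) l(2) by (simp add: inverted_ups_def)
      then show ?thesis using x'(2) y'(2) xy by force
    qed
  next
    fix z assume "z \<in> ?R"
    then show "z \<in> ?L" unfolding inverted_ups_def l(3) using l(1,2) le by auto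
  qed
  moreover have "card (map_prod (shift k) (shift k) ` ?I) = card ?I"
    by (rule card_image) (auto simp: inj_on_def)
  moreover have "card ((\<lambda>x. (k, shift k x)) ` ?B) = card ?B"
    by (rule card_image) (auto simp: inj_on_def)
  moreover have "map_prod (shift k) (shift k) ` ?I \<inter> (\<lambda>x. (k, shift k x)) ` ?B = {}"
    by (auto simp: inverted_ups_def)
  ultimately show ?thesis by (simp add: card_Un_disjoint finite_inverted_ups)
qed

section \<open>The effect of strip-growing on art\<close>

lemma finite_trace: "finite (trace P w)"
  by (cases P) simp

lemma finite_skew_shape:
  assumes "finite lo" "finite up"
  shows "finite (skew_shape lo up)"
proof (rule finite_subset)
  show "skew_shape lo up \<subseteq> (\<Union>z\<in>lo. \<Union>z'\<in>up. {fst z} \<times> {snd z..snd z'})"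
  proof
    fix z assume "z \<in> skew_shape lo up"
    then obtain x y l u where "z = (x, y)" "(x, l) \<in> lo" "(x, u) \<in> up" "l \<le> y" "y \<le> u"
      by (force simp: skew_shape_def)
    then show "z \<in> (\<Union>z\<in>lo. \<Union>z'\<in>up. {fst z} \<times> {snd z..snd z'})"
      by (intro UN_I[of "(x, l)"] UN_I[of "(x, u)"]) auto
  qed
qed (use assms in auto)

lemma finite_spread: "finite S \<Longrightarrow> finite (spread s S)"
  by (rule finite_subset[of _ "(\<lambda>(x, y). (x - 1, y)) ` S \<union> (\<lambda>(x, y). (x, y + 1)) ` S \<union> (\<lambda>(x, y). (x + 1, y)) ` S"])
    (force simp: spread_def)+

text \<open>A point off column \<open>s\<close> is moved, a point in column \<open>s\<close> is
  replaced by three: one to the left, one raised, one to the right. The left and right parts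
  \<open>Sl\<close> and \<open>Sr\<close> both contain column \<open>s\<close>, which gives its two
  extra copies together with \<open>Xc\<close>.\<close>

lemma card_spread:
  assumes "finite S"
  shows "card (spread s S) = card S + 2 * card {y. (s, y) \<in> S}"
proof -
  define C where "C = {y. (s, y) \<in> S}"
  define Sl Sr where "Sl = {z \<in> S. fst z \<le> s}" and "Sr = {z \<in> S. s \<le> fst z}"
  have fin: "finite Sl" "finite Sr" "finite C"
    using assms finite_vimageI[of S "Pair s"] by (auto simp: Sl_def Sr_def C_def vimage_def inj_on_def)
  define Xl Xc Xr where "Xl = (\<lambda>(x, y). (x - 1, y)) ` Sl" and "Xc = (\<lambda>y. (s, y + 1)) ` C"
    and "Xr = (\<lambda>(x, y). (x + 1, y)) ` Sr"
  have X: "fst z < s" if "z \<in> Xl" for z using that by (auto simp: Xl_def Sl_def)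
  have Y: "fst z = s" if "z \<in> Xc" for z using that by (auto simp: Xc_def)
  have Z: "s < fst z" if "z \<in> Xr" for z using that by (auto simp: Xr_def Sr_def)
  have "spread s S = Xl \<union> Xc \<union> Xr"
    unfolding Xl_def Xc_def Xr_def by (auto simp: spread_def Sl_def Sr_def C_def image_def)
  moreover have "Xl \<inter> Xc = {}" "(Xl \<union> Xc) \<inter> Xr = {}" using X Y Z by fastforce+
  moreover have "finite Xl" "finite Xc" "finite Xr" using fin by (simp_all add: Xl_def Xc_def Xr_def)
  ultimately have "card (spread s S) = card Xl + card Xc + card Xr"
    by (simp add: card_Un_disjoint)
  moreover have "card Xl = card Sl" "card Xc = card C" "card Xr = card Sr"
    unfolding Xl_def Xc_def Xr_def by (rule card_image, auto simp: inj_on_def)+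
  moreover have "card Sl + card Sr = card (Sl \<union> Sr) + card (Sl \<inter> Sr)"
    by (rule card_Un_Int[OF fin(1,2)])
  moreover have "Sl \<union> Sr = S" by (auto simp: Sl_def Sr_def)
  moreover have "Sl \<inter> Sr = Pair s ` C" by (auto simp: Sl_def Sr_def C_def)
  moreover have "card (Pair s ` C) = card C" by (rule card_image) (simp add: inj_on_def)
  ultimately show ?thesis by (simp add: C_def)
qed

text \<open>Keeps distinct tiles distinct, so that spreading preserves their number. Each point
  leaves a trace that determines it: one step further left if it is left of \<open>s\<close>, one
  step further right if it is right of \<open>s\<close>, and raised by 1 in column
  \<open>s\<close>.\<close>

lemma spread_inject: "spread s P = spread s Q \<longleftrightarrow> P = Q"
proof
  assume eq: "spread s P = spread s Q"
  have "(x, y) \<in> P \<longleftrightarrow> (x, y) \<in> Q" for x y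
    using eq mem_spread[of "x - 1" y s] mem_spread[of x "y + 1" s] mem_spread[of "x + 1" y s]
    by (cases x s rule: linorder_cases) auto
  then show "P = Q" by auto
qed simp

lemma up_starts_trace:
  "up_starts (a + int k) (trace (a, h) w) =
    (\<lambda>j. (a + int j, h + height (take j w))) ` {j \<in> ups w. k \<le> j}"
proof (intro set_eqI iffI)
  fix z assume "z \<in> up_starts (a + int k) (trace (a, h) w)"
  then obtain x y where z: "z = (x, y)" "(x, y) \<in> trace (a, h) w"
      "(x + 1, y + 1) \<in> trace (a, h) w" "a + int k \<le> x"
    by (auto simp: up_starts_def simp del: trace.simps)
  define j where "j = nat (x - a)"
  have x: "x = a + int j" "nat (x + 1 - a) = Suc j" using z(4) by (auto simp: j_def)
  have j: "j < length w" "y = h + height (take j w)" "y + 1 = h + height (take (Suc j) w)" "k \<le> j"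
    using z(2-4) x unfolding mem_trace by auto
  then have "j \<in> ups w" using height_take_Suc[OF j(1)] by (auto simp: ups_def split: if_splits)
  then show "z \<in> (\<lambda>j. (a + int j, h + height (take j w))) ` {j \<in> ups w. k \<le> j}"
    using z(1) x(1) j by blast
next
  fix z assume "z \<in> (\<lambda>j. (a + int j, h + height (take j w))) ` {j \<in> ups w. k \<le> j}"
  then obtain j where j: "z = (a + int j, h + height (take j w))" "j \<in> ups w" "k \<le> j" by blast
  then have "nat (a + int j + 1 - a) = Suc j" "j < length w" "w ! j = U" by (auto simp: ups_def)
  then show "z \<in> up_starts (a + int k) (trace (a, h) w)"
    using j height_take_Suc[of j w] unfolding up_starts_def mem_Collect_eq j(1) split mem_trace by auto
qed

text \<open>Lower corners in one column are 2 apart, and the two paths have heights of equal parity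
  there, so the boxes fill the gap between them without remainder.\<close>

lemma double_card_column:
  assumes "k \<le> length l" "length l = length m" "height (take k l) \<le> height (take k m)"
  shows "2 * int (card {y. (a + int k, y) \<in> skew_shape (trace (a, h) l) (trace (a, h) m)}) =
    height (take k m) - height (take k l)"
proof -
  define d where "d = nat ((height (take k m) - height (take k l)) div 2)"
  have d: "height (take k m) = height (take k l) + 2 * int d"
    using even_height_diff_length[of "take k m"] even_height_diff_length[of "take k l"] assms
    unfolding d_def by simp
  have "(a + int k, y) \<in> skew_shape (trace (a, h) l) (trace (a, h) m) \<longleftrightarrow>
      h + height (take k l) \<le> y \<and> y + 2 \<le> h + height (take k l) + 2 * int d \<and>
      even (y - (h + height (take k l)))" for y
    using assms(1,2) d unfolding skew_shape_def mem_Collect_eq split mem_trace by auto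
  moreover have "b \<le> y \<and> y + 2 \<le> b + 2 * int d \<and> even (y - b) \<longleftrightarrow> (\<exists>i<d. y = b + 2 * int i)" for b y
  proof
    assume *: "b \<le> y \<and> y + 2 \<le> b + 2 * int d \<and> even (y - b)"
    then obtain c where "y - b = 2 * c" by (elim conjE evenE)
    with * show "\<exists>i<d. y = b + 2 * int i" by (intro exI[of _ "nat c"]) auto
  qed auto
  ultimately have "{y. (a + int k, y) \<in> skew_shape (trace (a, h) l) (trace (a, h) m)} =
      (\<lambda>i. h + height (take k l) + 2 * int i) ` {..<d}"
    by (simp only:) blast
  then show ?thesis using d by (simp add: card_image inj_on_def)
qed

text \<open>The boxes in column \<open>s\<close> count half the height difference there, and the new boxes count the up
  steps of the upper path to the right; the height of the upper path cancels from the sum.\<close>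

lemma art_sgrow:
  assumes T: "dyck_tiling n T" and l: "dyck_path n l" "lower T = trace (- int n, 0) l"
    and k: "k \<le> 2 * n"
  shows "art (sgrow T (int k - int n)) = art T + real (card {x \<in> ups l. k \<le> x})"
proof -
  obtain l0 m where l0: "dyck_path n l0" "lower T = trace (- int n, 0) l0"
    and m: "dyck_path n m" "upper T = trace (- int n, 0) m"
    and le: "\<And>j. j \<le> 2 * n \<Longrightarrow> height (take j l0) \<le> height (take j m)"
    and part: "partition_on (skew_shape (lower T) (upper T)) (tiles T)"
    using T unfolding dyck_tiling_def by blast
  define s S where "s = - int n + int k" and "S = skew_shape (lower T) (upper T)"
  have len: "length l = 2 * n" "length l0 = 2 * n" "length m = 2 * n" "height l = 0" "height m = 0"
    using l l0 m by (auto simp: dyck_path_def)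
  have kl: "k \<le> length l" "k \<le> length m" using k len by simp_all
  \<comment> \<open>\<open>dyck_tiling\<close> provides only some word \<open>l0\<close> for the
    lower path. Since \<open>l0\<close> and \<open>l\<close> trace the same points and a trace has
    one height per column, they agree at \<open>s\<close>, where the comparison is needed.\<close>
  have "(s, height (take k l0)) \<in> trace (- int n, 0) l0"
    unfolding mem_trace using k len by (simp add: s_def)
  then have "(s, height (take k l0)) \<in> trace (- int n, 0) l"
    using l(2) l0(2) by (simp only:)
  then have Hle: "height (take k l) \<le> height (take k m)"
    unfolding mem_trace using le[OF k] by (simp add: s_def)
  define A where "A = up_starts s (spread s (upper T))"
  define m' where "m' = insert2 k U D m"
  have up: "spread s (upper T) = trace (- int n - 1, 0) m'"
    unfolding m(2) s_def m'_def by (rule spread_trace[OF kl(2)])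
  have finS: "finite S" unfolding S_def l(2) m(2) by (intro finite_skew_shape finite_trace)
  have "card A = card {x \<in> ups m. k \<le> x}"
  proof -
    \<comment> \<open>The spread path starts one column further left, so \<open>s\<close> is its
      position \<open>Suc k\<close>, the top of the inserted peak. The up step of that peak starts
      left of \<open>s\<close> and receives no box.\<close>
    have "s = - int n - 1 + int (Suc k)" by (simp add: s_def)
    then have "A = (\<lambda>j. (- int n - 1 + int j, 0 + height (take j m'))) ` {j \<in> ups m'. Suc k \<le> j}"
      unfolding A_def up by (simp only: up_starts_trace)
    moreover have "{j \<in> ups m'. Suc k \<le> j} = shift k ` {x \<in> ups m. k \<le> x}"
      unfolding m'_def ups_insert2[OF kl(2)] by (auto simp: Suc_le_eq)
    ultimately show ?thesis by (simp add: card_image inj_on_def)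
  qed
  then have cardA: "2 * int (card A) = int (2 * n) - int k - height (take k m)"
    using double_card_ups_ge[OF kl(2)] len by simp
  have finA: "finite A"
    unfolding A_def up by (rule finite_subset[OF _ finite_trace]) (auto simp: up_starts_def simp del: trace.simps)
  \<comment> \<open>A box of the spread shape has its upper corner on or below the upper path,
    whereas a new box has its lower corner on that path.\<close>
  have disj: "spread s S \<inter> A = {}"
  proof -
    have *: "u = y" if "(x, u) \<in> spread s (upper T)" "(x, y) \<in> spread s (upper T)" for x y u
      using that unfolding up mem_trace by simp
    have **: "\<exists>u. (x, u) \<in> spread s (upper T) \<and> y + 2 \<le> u" if "(x, y) \<in> spread s S" for x y
      using that unfolding S_def skew_shape_spread[symmetric] unfolding skew_shape_def by blast
    have "A \<subseteq> spread s (upper T)" unfolding A_def up_starts_def by blast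
    then have "(x, y) \<notin> A" if "(x, y) \<in> spread s S" for x y
      using *[of x _ y] **[OF that] by (metis add_le_same_cancel1 not_numeral_le_zero subsetD)
    then show ?thesis by auto
  qed
  have UT: "\<Union>(tiles T) = S" using part by (simp add: partition_on_def S_def)
  have tiles: "tiles (sgrow T s) = spread s ` tiles T \<union> (\<lambda>c. {c}) ` A"
    by (auto simp: sgrow_def Let_def spread_tiling_def A_def)
  have "\<Union>(tiles (sgrow T s)) = spread s S \<union> A"
    unfolding tiles Union_Un_distrib spread_Union UT by auto
  then have area: "area (sgrow T s) = card S + 2 * card {y. (s, y) \<in> S} + card A"
    using disj finS finA by (simp add: area_def card_Un_disjoint card_spread finite_spread)
  have "spread s ` tiles T \<inter> (\<lambda>c. {c}) ` A = {}"
  proof -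
    have "\<Union>(spread s ` tiles T) = spread s S" unfolding spread_Union UT ..
    then show ?thesis using disj by blast
  qed
  moreover have "finite (tiles T)" using finite_elements[OF finS] part by (simp add: S_def)
  moreover have "inj_on (spread s) (tiles T)" by (simp add: inj_on_def spread_inject)
  ultimately have ntiles: "card (tiles (sgrow T s)) = card (tiles T) + card A"
    unfolding tiles using finA by (simp add: card_Un_disjoint card_image)
  have "2 * int (card {y. (s, y) \<in> S}) = height (take k m) - height (take k l)"
    unfolding s_def S_def l(2) m(2) by (rule double_card_column[OF kl(1) _ Hle]) (simp add: len)
  with cardA have "card {y. (s, y) \<in> S} + card A = card {x \<in> ups l. k \<le> x}"
    using double_card_ups_ge[OF kl(1)] len by simp
  then have "real (card {y. (s, y) \<in> S}) + real (card A) = real (card {x \<in> ups l. k \<le> x})"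
    by (metis of_nat_add)
  moreover have "area T = card S" using UT by (simp add: area_def)
  moreover have "int k - int n = s" by (simp add: s_def)
  ultimately show ?thesis using area ntiles by (simp add: art_def field_simps)
qed

text \<open>Strip-growing adds boxes along the upper path only, so the lower path is merely spread,
  which inserts a peak into its word. This identifies the up steps counted in
  \<open>art_sgrow\<close> with those of the grown path.\<close>

lemma lower_DTS: "growth_sequence n p \<Longrightarrow> lower (DTS p) = trace (- int n, 0) (grown_path p)"
proof (induction n arbitrary: p)
  case 0
  then show ?case
    by (simp add: growth_sequence_0 DTS_def empty_tiling_def grown_path_def grow_def)
next
  case (Suc n)
  then obtain q k where q: "p = q @ [k]" "growth_sequence n q" "k \<le> 2 * n"
    by (blast elim: growth_sequence_SucE)
  then have n: "length q = n" and k: "k \<le> length (grown_path q)"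
    by (simp_all add: length_grown_path growth_sequence_def)
  \<comment> \<open>Column \<open>k - n\<close> is position \<open>k\<close> of a path that starts
    at column \<open>- n\<close>.\<close>
  have "lower (DTS p) = spread (- int n + int k) (trace (- int n, 0) (grown_path q))"
    using Suc.IH[OF q(2)] unfolding q(1) DTS_snoc[OF n]
    by (simp add: sgrow_def Let_def spread_tiling_def)
  also have "\<dots> = trace (- int n - 1, 0) (grown_path p)"
    unfolding q(1) grown_path_snoc by (rule spread_trace[OF k])
  also have "- int n - 1 = - int (Suc n)" by simp
  finally show ?case .
qed

lemma art_DTS:
  "growth_sequence n p \<Longrightarrow>
    art (DTS p) = real (card (inverted_ups (grown_path p) (\<lambda>x. snd (grow p ! x))))"
proof (induction n arbitrary: p)
  case 0
  then show ?case
    by (simp add: growth_sequence_0 DTS_def empty_tiling_def grown_path_def grow_def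
        art_def area_def inverted_ups_def ups_def)
next
  case (Suc n)
  then obtain q k where q: "p = q @ [k]" "growth_sequence n q" "k \<le> 2 * n"
    by (blast elim: growth_sequence_SucE)
  have n: "length q = n" using q by (simp add: growth_sequence_def)
  show ?case
    unfolding q(1) DTS_snoc[OF n] card_inverted_ups_snoc[OF q(2,3)]
    using art_sgrow[OF dyck_tiling_DTS[OF q(2)] dyck_path_grown_path[OF q(2)] lower_DTS[OF q(2)] q(3)]
      Suc.IH[OF q(2)] by simp
qed

theorem theorem5:
  fixes n :: nat and w :: "step list" and \<sigma> :: "nat \<Rightarrow> nat"
  assumes "dyck_path n w"
    and "\<sigma> \<in> linear_extensions n w"
  shows "art (DTS_of n w \<sigma>) = real (inversions n \<sigma>)"
proof -
  note w = assms(1)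
  obtain L where L: "\<sigma> = perm_of n w L" "bij_betw L (chords w) {1..n}"
      "\<And>c c'. c \<in> chords w \<Longrightarrow> c' \<in> chords w \<Longrightarrow> chord_less c c' \<Longrightarrow> L c < L c'"
    using assms(2) unfolding linear_extensions_def natural_labeling_def by blast
  have b: "bij_betw fst (chords w) (ups w)" by (rule bij_betw_fst_chords[OF w])
  define f where "f = L \<circ> inv_into (chords w) fst"
  have Lf: "L c = f (fst c)" if "c \<in> chords w" for c
    using b that by (simp add: f_def bij_betw_def)
  have f: "bij_betw f (ups w) {1..n}"
    unfolding f_def by (rule bij_betw_trans[OF bij_betw_inv_into[OF b] L(2)])
  obtain p where p: "growth_sequence n p" "grown_path p = w" "\<And>x. x \<in> ups w \<Longrightarrow> snd (grow p ! x) = f x"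
    using growth_sequence_exists[OF w f] Lf L(3) by fastforce
  have label: "grown_labeling q c = (\<lambda>x. snd (grow q ! x)) (fst c)" for q c
    by (simp add: grown_labeling_def)
  have bp: "bij_betw (\<lambda>x. snd (grow q ! x)) (ups w) {1..n}" if "growth_sequence n q" "grown_path q = w" for q
    using bij_betw_label[OF that(1)] that(2) by simp
  have Lp: "L c = (\<lambda>x. snd (grow p ! x)) (fst c)" if "c \<in> chords w" for c
    using Lf[OF that] p(3)[OF bij_betwE[OF b, rule_format, OF that]] by simp
  have "grown_labeling p c = L c" if "c \<in> chords w" for c
    using Lp[OF that] by (simp add: grown_labeling_def)
  \<comment> \<open>The two labelings agree on the chords of \<open>w\<close> only, but
    \<open>inv_into\<close> consults no other arguments, so the inverses are equal as
    functions.\<close>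
  then have "inv_into (chords w) (grown_labeling p) = inv_into (chords w) L"
    by (auto simp: inv_into_def fun_eq_iff intro!: arg_cong[where f = Eps])
  then have perm: "perm_of n w (grown_labeling p) = \<sigma>"
    unfolding L(1) by (simp add: perm_of_def fun_eq_iff)
  have "growth_of n w \<sigma> = p"
    unfolding growth_of_def
  proof (rule the_equality)
    fix q assume q: "growth_sequence n q \<and> grown_path q = w \<and> perm_of n w (grown_labeling q) = \<sigma>"
    show "q = p"
    proof (rule growth_sequence_unique)
      fix x assume "x \<in> ups (grown_path q)"
      then have x: "x \<in> ups w" using q by simp
      \<comment> \<open>Both sequences induce \<sigma> on the same path, and the permutation
        determines the labels.\<close>
      show "snd (grow q ! x) = snd (grow p ! x)"
        by (rule perm_of_label_inj[OF w bp label bp label _ x]) (use q p(1,2) perm in auto)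
    qed (use q p in auto)
  qed (use p perm in auto)
  then show ?thesis
    using art_DTS[OF p(1)] inversions_perm_of[OF w bp[OF p(1,2)] Lp] p(2)
    by (simp add: DTS_of_def L(1))
qed

end
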